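(* Let $n\in\mathbb{N}$ and let $A$ be a semisimple commutative unital Banach algebra such that the Gelfand space $\Delta(A)$ is connected. Let $f:\mathbb{R}^n\to A$ be a continuous function such that $f(z)\in A^{-1}$ for all $z\in\mathbb{R}^n$. Then there is a unique continuous function $g:\mathbb{R}^n\to A$ such that $g(0)=0_A$ and $$f(z)=f(0)\exp(g(z))\quad\text{for all }z\in\mathbb{R}^n.$$
   Context: All Banach algebras are complex; a commutative Banach algebra $A$ is unital if it has an identity $e_A$ with $\|e_A\|_A=1$. $0_A$ is the zero element, $A^{-1}$ is the set of invertible elements, and $\exp(a)=\sum_{j=0}^\infty a^j/j!$ with $a^0=e_A$. The Gelfand space $\Delta(A)$ is the set of all non-zero multiplicative linear maps $\varphi:A\to\mathbb{C}$, equipped with the weak-$\ast$ topology (the weakest topology making $\varphi\mapsto\varphi(a)$ continuous for every $a\in A$). $A$ is semisimple if for every $a\in A\setminus\{0_A\}$ there is $\varphi\in\Delta(A)$ with $\varphi(a)\neq0$. *)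

theory Defs
  imports "HOL-Analysis.Analysis"
begin

text \<open>
  The library's normed algebras are real. A complex one is given here as a real one (which fixes
  norm, metric, topology, completeness, \<^term>\<open>norm 1 = 1\<close> and \<^const>\<open>exp\<close>) together with a
  complex scalar multiplication that restricts to the real one. The requirement that the algebra
  be non-trivial, built into the real classes, already follows from \<^term>\<open>norm 1 = 1\<close>.
\<close>

class comm_complex_banach_algebra_1 = real_normed_algebra_1 + banach + comm_ring_1 +
  fixes scaleC :: "complex \<Rightarrow> 'a \<Rightarrow> 'a"  (infixr "*\<^sub>C" 75)
  assumes scaleC_add_right: "c *\<^sub>C (x + y) = c *\<^sub>C x + c *\<^sub>C y"
    and scaleC_add_left: "(c + d) *\<^sub>C x = c *\<^sub>C x + d *\<^sub>C x"
    and scaleC_scaleC: "c *\<^sub>C (d *\<^sub>C x) = (c * d) *\<^sub>C x"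
    and scaleC_one: "1 *\<^sub>C x = x"
    and scaleC_mult_left: "(c *\<^sub>C x) * y = c *\<^sub>C (x * y)"
    and norm_scaleC: "norm (c *\<^sub>C x) = cmod c * norm x"
    and scaleC_of_real: "complex_of_real r *\<^sub>C x = r *\<^sub>R x"

instantiation complex :: comm_complex_banach_algebra_1
begin

definition scaleC_complex :: "complex \<Rightarrow> complex \<Rightarrow> complex"
  where "scaleC_complex = (*)"

instance
  by standard (simp_all add: scaleC_complex_def algebra_simps norm_mult scaleR_conv_of_real)

end

lemma vector_space_scaleC:
  "vector_space (scaleC :: complex \<Rightarrow> 'a :: comm_complex_banach_algebra_1 \<Rightarrow> 'a)"
  by standard (simp_all add: scaleC_add_right scaleC_add_left scaleC_scaleC scaleC_one)

definition characters :: "('a :: comm_complex_banach_algebra_1 \<Rightarrow> complex) set"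
  where "characters =
    {\<phi>. Vector_Spaces.linear scaleC (*) \<phi> \<and> (\<forall>a b. \<phi> (a * b) = \<phi> a * \<phi> b) \<and> (\<exists>a. \<phi> a \<noteq> 0)}"

text \<open>
  Taking \<^term>\<open>U = UNIV\<close> below shows that the underlying set of the Gelfand space is
  \<^const>\<open>characters\<close>.
\<close>

definition gelfand_space :: "('a :: comm_complex_banach_algebra_1 \<Rightarrow> complex) topology"
  where "gelfand_space =
    topology_generated_by {{\<phi> \<in> characters. \<phi> a \<in> U} | a U. open U}"

lemma topspace_gelfand_space: "topspace gelfand_space = characters"
  unfolding gelfand_space_def topology_generated_by_topspace by blast

definition semisimple :: "'a :: comm_complex_banach_algebra_1 itself \<Rightarrow> bool"
  where "semisimple _ \<longleftrightarrow> (\<forall>a :: 'a. a \<noteq> 0 \<longrightarrow> (\<exists>\<phi> \<in> topspace gelfand_space. \<phi> a \<noteq> 0))"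

end

theory Submission
  imports Defs
begin

text \<open>
  Near \<open>0\<close> the map \<open>exp x - x\<close> is a contraction, so \<open>exp\<close> is injective there and has a continuous
  right inverse near \<open>1\<close>. Local injectivity and connectedness of the domain show that logarithms
  of the same function that agree at one point are equal. On a ball, uniform continuity makes the
  quotients of \<open>f\<close> at consecutive points \<open>(k / N) z\<close> close to \<open>1\<close>, and the sum of their local
  logarithms is a logarithm of \<open>f z / f 0\<close>; by uniqueness the logarithms on growing balls fit
  together.
\<close>

section \<open>The exponential near 0\<close>

lemma norm_exp_minus_1_minus_self_le:
  fixes d :: "'a :: {real_normed_algebra_1, banach}"
  assumes "norm d \<le> 1"
  shows "norm (exp d - 1 - d) \<le> (norm d)\<^sup>2"
proof -
  let ?F = "\<lambda>x n. x ^ (n + 2) /\<^sub>R fact (n + 2)"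
  have summable: "summable (?F (norm d))"
    using summable_ignore_initial_segment[OF summable_exp_generic] .
  have le: "norm (?F d n) \<le> ?F (norm d) n" for n
    unfolding norm_scaleR using norm_power_ineq[of d "n + 2"] by (simp add: mult_left_mono)
  \<comment> \<open>The tail of the series is dominated termwise by the same tail at the real number
    \<open>norm d\<close>, so the real bound \<open>exp x \<le> 1 + x + x\<^sup>2\<close> on the
    unit interval applies.\<close>
  have "norm (exp d - 1 - d) = norm (\<Sum>n. ?F d n)"
    using exp_first_two_terms[of d] by simp
  also have "\<dots> \<le> (\<Sum>n. ?F (norm d) n)"
    using norm_suminf_le[OF le summable] .
  also have "\<dots> = exp (norm d) - 1 - norm d"
    using exp_first_two_terms[of "norm d"] by simp
  also have "\<dots> \<le> (norm d)\<^sup>2"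
    using exp_bound[of "norm d"] assms by simp
  finally show ?thesis .
qed

text \<open>With \<open>y = x + d\<close> the difference is
  \<open>(exp x - 1) * (exp d - 1) + (exp d - 1 - d)\<close>. The radius 1/12 gives
  \<open>norm (exp x - 1) \<le> 1 / 6\<close> and \<open>norm d \<le> 1 / 6\<close>, so the factors
  of \<open>norm d\<close> add up to 2/6 + 1/6 = 1/2.\<close>

lemma exp_minus_self_lipschitz:
  fixes x y :: "'a :: {real_normed_algebra_1, banach, comm_ring_1}"
  assumes "norm x \<le> 1 / 12" "norm y \<le> 1 / 12"
  shows "norm ((exp y - y) - (exp x - x)) \<le> norm (y - x) / 2"
proof -
  define d where "d = y - x"
  have d: "norm d \<le> 1 / 6"
    using norm_triangle_ineq4[of y x] assms by (simp add: d_def)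
  have exp_bound: "norm (exp a - 1) \<le> 2 * norm a" if "norm a \<le> 1" for a :: 'a
  proof -
    have "norm (exp a - 1) \<le> norm (exp a - 1 - a) + norm a"
      using norm_triangle_ineq[of "exp a - 1 - a" a] by simp
    also have "\<dots> \<le> (norm a)\<^sup>2 + norm a"
      using norm_exp_minus_1_minus_self_le[OF that] by simp
    also have "\<dots> \<le> 2 * norm a"
      using that mult_left_le[of "norm a" "norm a"] by (simp add: power2_eq_square)
    finally show ?thesis .
  qed
  have "exp y = exp x * exp d"
    using exp_add_commuting[of x d] by (simp add: d_def mult.commute)
  then have "(exp y - y) - (exp x - x) = (exp x - 1) * (exp d - 1) + (exp d - 1 - d)"
    by (simp add: d_def algebra_simps)
  also have "norm \<dots> \<le> norm (exp x - 1) * norm (exp d - 1) + norm (exp d - 1 - d)"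
    by (rule order_trans[OF norm_triangle_ineq]) (simp add: norm_mult_ineq)
  also have "\<dots> \<le> (1 / 6) * (2 * norm d) + norm d * (1 / 6)"
  proof (intro add_mono mult_mono)
    show "norm (exp x - 1) \<le> 1 / 6"
      using exp_bound[of x] assms by linarith
    show "norm (exp d - 1) \<le> 2 * norm d"
      using exp_bound[of d] d by linarith
    have "norm (exp d - 1 - d) \<le> norm d * norm d"
      using norm_exp_minus_1_minus_self_le[of d] d by (simp add: power2_eq_square)
    also have "\<dots> \<le> norm d * (1 / 6)"
      using d by (intro mult_left_mono) auto
    finally show "norm (exp d - 1 - d) \<le> norm d * (1 / 6)" .
  qed auto
  finally show ?thesis
    by (simp add: d_def)
qed

text \<open>A 1/2-Lipschitz perturbation of the identity shrinks distances at most by half. This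
  gives injectivity on the ball and a Lipschitz constant for the local inverse.\<close>

lemma exp_locally_expanding:
  fixes x y :: "'a :: {real_normed_algebra_1, banach, comm_ring_1}"
  assumes "norm x \<le> 1 / 12" "norm y \<le> 1 / 12"
  shows "norm (y - x) \<le> 2 * norm (exp y - exp x)"
proof -
  have "y - x = (exp y - exp x) - ((exp y - y) - (exp x - x))"
    by simp
  then have "norm (y - x) \<le> norm (exp y - exp x) + norm ((exp y - y) - (exp x - x))"
    by (metis norm_triangle_ineq4)
  then show ?thesis
    using exp_minus_self_lipschitz[OF assms] by linarith
qed

lemma exp_locally_onto:
  fixes u :: "'a :: {real_normed_algebra_1, banach, comm_ring_1}"
  assumes u: "norm (u - 1) \<le> 1 / 24"
  obtains x where "norm x \<le> 1 / 12" "exp x = u"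
proof -
  \<comment> \<open>The fixed points of \<open>?T\<close> are the solutions of
    \<open>exp x = u\<close>.\<close>
  let ?T = "\<lambda>x. u - (exp x - x)"
  have lip: "norm (?T x - ?T y) \<le> norm (x - y) / 2"
    if "norm x \<le> 1 / 12" "norm y \<le> 1 / 12" for x y
    using exp_minus_self_lipschitz[OF that] by (simp add: norm_minus_commute algebra_simps)
  have "\<exists>!x\<in>cball 0 (1 / 12). ?T x = x"
  proof (rule Banach_fix)
    show "?T ` cball 0 (1 / 12) \<subseteq> cball 0 (1 / 12)"
    proof clarify
      fix x :: 'a
      assume "x \<in> cball 0 (1 / 12)"
      then have x: "norm x \<le> 1 / 12"
        by simp
      \<comment> \<open>Here \<open>?T 0 = u - 1\<close>, so the bound is 1/24 + (1/12)/2 = 1/12;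
        this fixes the radius 1/24.\<close>
      have "norm (?T x) \<le> norm (?T 0) + norm (?T x - ?T 0)"
        by (rule norm_triangle_sub)
      then show "?T x \<in> cball 0 (1 / 12)"
        using lip[OF x, of 0] x u by simp
    qed
    show "dist (?T x) (?T y) \<le> 1 / 2 * dist x y"
      if "x \<in> cball 0 (1 / 12)" "y \<in> cball 0 (1 / 12)" for x y
      using lip[of x y] that by (simp add: dist_norm)
  qed (auto simp: complete_eq_closed)
  then show thesis
    using that by (auto simp: algebra_simps)
qed

lemma local_logarithm:
  obtains L :: "'a :: {real_normed_algebra_1, banach, comm_ring_1} \<Rightarrow> 'a"
  where "continuous_on (cball 1 (1 / 24)) L" "L 1 = 0"
    and "\<And>u. u \<in> cball 1 (1 / 24) \<Longrightarrow> exp (L u) = u"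
proof -
  have "\<forall>u \<in> cball 1 (1 / 24). \<exists>x :: 'a. norm x \<le> 1 / 12 \<and> exp x = u"
    by (metis exp_locally_onto mem_cball dist_norm norm_minus_commute)
  then obtain L :: "'a \<Rightarrow> 'a" where
    L: "norm (L u) \<le> 1 / 12" "exp (L u) = u" if "u \<in> cball 1 (1 / 24)" for u
    by metis
  show thesis
  proof
    \<comment> \<open>\<open>L\<close> was chosen pointwise; its continuity comes from
      \<open>exp\<close> being expanding on the ball that contains its values.\<close>
    have "2-lipschitz_on (cball 1 (1 / 24)) L"
    proof (rule lipschitz_onI)
      show "dist (L u) (L v) \<le> 2 * dist u v"
        if "u \<in> cball 1 (1 / 24)" "v \<in> cball 1 (1 / 24)" for u v
        using exp_locally_expanding[of "L v" "L u"] L[OF that(1)] L[OF that(2)]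
        by (simp add: dist_norm)
    qed simp
    then show "continuous_on (cball 1 (1 / 24)) L"
      by (rule lipschitz_on_continuous_on)
    show "L 1 = 0"
      using exp_locally_expanding[of 0 "L 1"] L[of 1] by simp
  qed (use L in auto)
qed

section \<open>Uniqueness of logarithms, continuity of inverses\<close>

lemma continuous_logarithm_unique:
  fixes g h :: "'b :: topological_space \<Rightarrow> 'a :: {real_normed_algebra_1, banach, comm_ring_1}"
  assumes "connected S" "continuous_on S g" "continuous_on S h"
    and exp_eq: "\<And>z. z \<in> S \<Longrightarrow> exp (g z) = exp (h z)"
    and w: "w \<in> S" "g w = h w"
    and "z \<in> S"
  shows "g z = h z"
proof -
  let ?d = "\<lambda>z. g z - h z"
  have cont: "continuous_on S ?d"
    using assms by (intro continuous_intros)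
  have exp_d: "exp (?d z) = 1" if "z \<in> S" for z
  proof -
    have "exp (?d z) = exp (g z) * exp (- h z)"
      using exp_add_commuting[of "g z" "- h z"] by (simp add: mult.commute)
    then show ?thesis
      using exp_eq[OF that] by (simp add: exp_minus_inverse)
  qed
  \<comment> \<open>Since \<open>exp (?d z) = 1 = exp 0\<close>, local injectivity leaves a gap
    around the value 0. The zero set of \<open>?d\<close> is thus also the preimage of an open ball,
    hence open as well as closed.\<close>
  have "?d z = 0" if "z \<in> S" "norm (?d z) < 1 / 12" for z
    using exp_locally_expanding[of 0 "?d z"] exp_d[OF that(1)] that(2) by simp
  then have "S \<inter> ?d -` {0} = S \<inter> ?d -` ball 0 (1 / 12)"
    by auto
  then have "openin (top_of_set S) (S \<inter> ?d -` {0})"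
    using continuous_openin_preimage_gen[OF cont open_ball] by metis
  moreover have "closedin (top_of_set S) (S \<inter> ?d -` {0})"
    using continuous_closedin_preimage[OF cont] by simp
  ultimately have "S \<inter> ?d -` {0} = {} \<or> S \<inter> ?d -` {0} = S"
    using \<open>connected S\<close> unfolding connected_clopen by blast
  moreover have "w \<in> S \<inter> ?d -` {0}"
    using w by simp
  ultimately have "z \<in> S \<inter> ?d -` {0}"
    using \<open>z \<in> S\<close> by blast
  then show ?thesis
    by simp
qed

text \<open>Pointwise inverses satisfy \<open>i z - i w = i z * ((f w - f z) * i w)\<close>, which
  tends to 0 once \<open>norm (i z)\<close> is bounded near \<open>w\<close>.\<close>

lemma continuous_on_mult_inverse:
  fixes f i :: "'b :: topological_space \<Rightarrow> 'a :: {real_normed_algebra_1, comm_ring_1}"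
  assumes cont: "continuous_on S f" and inv: "\<And>z. z \<in> S \<Longrightarrow> f z * i z = 1"
  shows "continuous_on S i"
  unfolding continuous_on_def
proof
  fix w
  assume w: "w \<in> S"
  have f: "(f \<longlongrightarrow> f w) (at w within S)"
    using cont w by (simp add: continuous_on_def)
  have "((\<lambda>z. norm (f w - f z) * norm (i w)) \<longlongrightarrow> norm (f w - f w) * norm (i w)) (at w within S)"
    by (intro tendsto_intros f)
  \<comment> \<open>The threshold 1/2 gives \<open>norm (i z - i w) \<le> norm (i z) / 2\<close>,
    hence \<open>norm (i z) \<le> 2 * norm (i w)\<close>, a bound independent of
    \<open>z\<close>.\<close>
  then have "\<forall>\<^sub>F z in at w within S. norm (f w - f z) * norm (i w) < 1 / 2"
    by (rule order_tendstoD) simp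
  moreover have "\<forall>\<^sub>F z in at w within S. z \<in> S"
    by (simp add: eventually_at_filter)
  ultimately have "\<forall>\<^sub>F z in at w within S. norm (i z - i w) \<le> 2 * (norm (i w))\<^sup>2 * norm (f w - f z)"
  proof eventually_elim
    case (elim z)
    have "i z - i w = (f w * i w) * i z - (f z * i z) * i w"
      using inv elim w by simp
    also have "\<dots> = i z * ((f w - f z) * i w)"
      by (simp add: algebra_simps)
    finally have "norm (i z - i w) \<le> norm (i z) * norm ((f w - f z) * i w)"
      by (metis norm_mult_ineq)
    also have "\<dots> \<le> norm (i z) * (norm (f w - f z) * norm (i w))"
      by (intro mult_left_mono norm_mult_ineq norm_ge_zero)
    finally have *: "norm (i z - i w) \<le> norm (i z) * (norm (f w - f z) * norm (i w))" .
    also have "\<dots> \<le> norm (i z) * (1 / 2)"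
      using elim by (intro mult_left_mono) auto
    finally have "norm (i z) \<le> 2 * norm (i w)"
      using norm_triangle_ineq2[of "i z" "i w"] by linarith
    then have "norm (i z) * (norm (f w - f z) * norm (i w))
        \<le> (2 * norm (i w)) * (norm (f w - f z) * norm (i w))"
      by (intro mult_right_mono) auto
    with * show ?case
      by (simp add: power2_eq_square mult_ac)
  qed
  moreover have "((\<lambda>z. 2 * (norm (i w))\<^sup>2 * norm (f w - f z))
      \<longlongrightarrow> 2 * (norm (i w))\<^sup>2 * norm (f w - f w)) (at w within S)"
    by (intro tendsto_intros f)
  ultimately have "((\<lambda>z. i z - i w) \<longlongrightarrow> 0) (at w within S)"
    by (auto intro: Lim_null_comparison)
  then show "(i \<longlongrightarrow> i w) (at w within S)"
    by (simp add: LIM_zero_iff)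
qed

section \<open>Existence on closed balls\<close>

lemma continuous_logarithm_on_cball:
  fixes f :: "'b :: euclidean_space \<Rightarrow> 'a :: {real_normed_algebra_1, banach, comm_ring_1}"
  assumes cont: "continuous_on (cball 0 R) f" and inv: "\<And>z. z \<in> cball 0 R \<Longrightarrow> f z dvd 1"
  obtains g where "continuous_on (cball 0 R) g" "g 0 = 0"
    and "\<And>z. z \<in> cball 0 R \<Longrightarrow> f z = f 0 * exp (g z)"
proof (cases "R \<ge> 0")
  case True
  define S where "S = cball (0 :: 'b) R"
  obtain i where i: "f z * i z = 1" if "z \<in> S" for z
    using inv unfolding S_def dvd_def by metis
  have cont_i: "continuous_on S i"
    using continuous_on_mult_inverse[of S f i] cont i by (simp add: S_def)
  have "compact S"
    by (simp add: S_def)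
  then have "bounded (i ` S)"
    using compact_continuous_image[OF cont_i] compact_imp_bounded by blast
  then obtain B where "B > 0" and B: "\<forall>z \<in> S. norm (i z) \<le> B"
    unfolding bounded_pos by auto
  have "uniformly_continuous_on S f"
    using cont \<open>compact S\<close> unfolding S_def by (rule compact_uniformly_continuous)
  \<comment> \<open>Multiplying a difference of values of \<open>f\<close> below this tolerance by
    an inverse of norm at most \<open>B\<close> keeps the quotient within 1/24 of 1, in the domain
    of the local logarithm.\<close>
  moreover have "1 / (24 * B) > 0"
    using \<open>B > 0\<close> by simp
  ultimately obtain e where e: "e > 0"
    and f_close: "\<And>z w. \<lbrakk>z \<in> S; w \<in> S; dist z w < e\<rbrakk>
      \<Longrightarrow> dist (f z) (f w) < 1 / (24 * B)"
    unfolding uniformly_continuous_on_def by metis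
  \<comment> \<open>One number of subdivisions serves all \<open>z\<close> in the ball, because
    consecutive points are at distance at most \<open>R / N\<close>.\<close>
  obtain N0 where "R / e < real N0"
    using reals_Archimedean2 by blast
  define N where "N = Suc N0"
  have N: "N > 0" "R / N < e"
  proof -
    have "R / e < real N"
      using \<open>R / e < real N0\<close> by (simp add: N_def)
    then show "R / N < e"
      using e by (simp add: N_def field_simps)
  qed (simp add: N_def)
  define pt where "pt k z = (real k / real N) *\<^sub>R z" for k and z :: 'b
  have pt_in: "pt k z \<in> S" if "z \<in> S" "k \<le> N" for k z
  proof -
    have "real k / real N * norm z \<le> 1 * R"
      using that N by (intro mult_mono) (auto simp: S_def)
    then show ?thesis
      by (simp add: pt_def S_def)
  qed
  define q where "q k z = f (pt (Suc k) z) * i (pt k z)" for k z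
  have q_in: "q k z \<in> cball 1 (1 / 24)" if z: "z \<in> S" and "k < N" for k z
  proof -
    have in_S: "pt (Suc k) z \<in> S" "pt k z \<in> S"
      using pt_in that by auto
    have "pt (Suc k) z - pt k z = (1 / real N) *\<^sub>R z"
      by (simp add: pt_def flip: scaleR_left_diff_distrib diff_divide_distrib)
    then have "dist (pt (Suc k) z) (pt k z) = norm z / N"
      by (simp add: dist_norm)
    also have "\<dots> \<le> R / N"
      using z by (intro divide_right_mono) (auto simp: S_def)
    finally have "dist (pt (Suc k) z) (pt k z) < e"
      using N by simp
    then have "norm (f (pt (Suc k) z) - f (pt k z)) \<le> 1 / (24 * B)"
      using f_close[OF in_S] by (simp add: dist_norm)
    then have "norm (f (pt (Suc k) z) - f (pt k z)) * norm (i (pt k z)) \<le> 1 / (24 * B) * B"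
      using B in_S \<open>B > 0\<close> by (intro mult_mono) auto
    moreover have "q k z - 1 = (f (pt (Suc k) z) - f (pt k z)) * i (pt k z)"
      using i[OF in_S(2)] by (simp add: q_def algebra_simps)
    ultimately have "norm (q k z - 1) \<le> 1 / 24"
      using \<open>B > 0\<close> norm_mult_ineq[of "f (pt (Suc k) z) - f (pt k z)" "i (pt k z)"]
      by simp
    then show ?thesis
      by (simp add: dist_norm norm_minus_commute)
  qed
  obtain L :: "'a \<Rightarrow> 'a" where L: "continuous_on (cball 1 (1 / 24)) L" "L 1 = 0"
    and exp_L: "\<And>u. u \<in> cball 1 (1 / 24) \<Longrightarrow> exp (L u) = u"
    using local_logarithm by blast
  define g where "g z = (\<Sum>k<N. L (q k z))" for z
  \<comment> \<open>The product of the quotients \<open>q k z\<close> telescopes, from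
    \<open>pt 0 z = 0\<close> up to \<open>pt N z = z\<close>.\<close>
  have partial: "f 0 * exp (\<Sum>k<m. L (q k z)) = f (pt m z)" if "m \<le> N" "z \<in> S" for m z
    using \<open>m \<le> N\<close>
  proof (induction m)
    case 0
    show ?case
      by (simp add: pt_def)
  next
    case (Suc m)
    have "exp (\<Sum>k<Suc m. L (q k z)) = exp (\<Sum>k<m. L (q k z)) * q m z"
      using exp_L[OF q_in[OF \<open>z \<in> S\<close>, of m]] Suc.prems
      by (simp add: exp_add_commuting[OF mult.commute])
    then have "f 0 * exp (\<Sum>k<Suc m. L (q k z)) = f (pt m z) * q m z"
      using Suc by (simp add: mult.assoc[symmetric])
    also have "\<dots> = f (pt (Suc m) z) * (f (pt m z) * i (pt m z))"
      by (simp add: q_def mult_ac)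
    finally show ?case
      using i[OF pt_in[OF \<open>z \<in> S\<close>, of m]] Suc by simp
  qed
  show thesis
  proof
    have "continuous_on S (\<lambda>z. L (q k z))" if "k < N" for k
    proof (rule continuous_on_compose2[OF L(1)])
      have pt: "continuous_on S (pt j)" for j
        unfolding pt_def by (intro continuous_intros)
      show "continuous_on S (q k)"
        unfolding q_def using that pt_in cont
        by (intro continuous_on_mult continuous_on_compose2[OF _ pt, of S f]
            continuous_on_compose2[OF cont_i pt]) (auto simp: S_def)
    qed (use q_in that in blast)
    then show "continuous_on (cball 0 R) g"
      unfolding g_def S_def[symmetric] by (intro continuous_on_sum) auto
    \<comment> \<open>At the origin all subdivision points coincide, so every summand of
      \<open>g 0\<close> is \<open>L 1 = 0\<close>.\<close>
    have "q k 0 = 1" for k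
      using i[of 0] True by (simp add: q_def pt_def S_def)
    then show "g 0 = 0"
      by (simp add: g_def L)
    show "f z = f 0 * exp (g z)" if "z \<in> cball 0 R" for z
      using partial[of N z] that N by (simp add: g_def pt_def S_def)
  qed
\<comment> \<open>For \<open>R < 0\<close> the ball is empty and only \<open>g 0 = 0\<close> has to
  be met.\<close>
qed (use that[of "\<lambda>_. 0"] in simp)

section \<open>Logarithms on the whole space\<close>

lemma continuous_logarithm:
  fixes f :: "'b :: euclidean_space \<Rightarrow> 'a :: {real_normed_algebra_1, banach, comm_ring_1}"
  assumes cont: "continuous_on UNIV f" and inv: "\<And>z. f z dvd 1"
  shows "\<exists>!g. continuous_on UNIV g \<and> g 0 = 0 \<and> (\<forall>z. f z = f 0 * exp (g z))"
proof -
  have cancel: "u = v" if "f 0 * u = f 0 * v" for u v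
  proof -
    obtain c where "1 = f 0 * c"
      using inv[of 0] by (auto simp: dvd_def)
    then show ?thesis
      using that by (metis mult.commute mult.left_commute mult_1)
  qed
  have "\<exists>g. continuous_on (cball 0 (real n)) g \<and> g 0 = 0
      \<and> (\<forall>z \<in> cball 0 (real n). f z = f 0 * exp (g z))" for n
    using continuous_logarithm_on_cball[of "real n" f] inv continuous_on_subset[OF cont subset_UNIV]
    by metis
  then obtain G where G: "continuous_on (cball 0 (real n)) (G n)" "G n 0 = 0"
    and exp_G: "z \<in> cball 0 (real n) \<Longrightarrow> f z = f 0 * exp (G n z)" for n z
    by metis
  have G_eq: "G m z = G n z" if "m \<le> n" "z \<in> cball 0 (real m)" for m n z
  proof (rule continuous_logarithm_unique[of "cball 0 (real m)" "G m" "G n" 0])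
    show "connected (cball (0 :: 'b) (real m))" "continuous_on (cball 0 (real m)) (G m)"
      using G by auto
    have sub: "cball 0 (real m) \<subseteq> cball (0 :: 'b) (real n)"
      using that by auto
    show "continuous_on (cball 0 (real m)) (G n)"
      using continuous_on_subset[OF G(1) sub] .
    show "exp (G m z) = exp (G n z)" if "z \<in> cball 0 (real m)" for z
      by (rule cancel) (metis exp_G sub subsetD that)
    show "0 \<in> cball 0 (real m)" "G m 0 = G n 0" "z \<in> cball 0 (real m)"
      using that G by auto
  qed
  \<comment> \<open>The index is the least natural number whose ball contains \<open>z\<close>; by
    \<open>G_eq\<close> any larger one gives the same value.\<close>
  define g where "g z = G (nat \<lceil>norm z\<rceil>) z" for z
  have norm_le: "norm z \<le> real (nat \<lceil>norm z\<rceil>)" for z :: 'b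
    by linarith
  have g_eq: "g z = G n z" if "z \<in> cball 0 (real n)" for z n
  proof -
    have "nat \<lceil>norm z\<rceil> \<le> n"
      using that by (simp add: ceiling_le_iff)
    then show ?thesis
      unfolding g_def using norm_le by (intro G_eq) auto
  qed
  have cont_g: "continuous_on UNIV g"
    unfolding continuous_on_eq_continuous_within
  proof
    fix z :: 'b
    \<comment> \<open>The strict inequality puts \<open>z\<close> in the interior of the ball, so
      continuity on the ball gives continuity at \<open>z\<close>.\<close>
    obtain n where "norm z < real n"
      using reals_Archimedean2 by blast
    moreover have "continuous_on (cball 0 (real n)) g"
      by (subst continuous_on_cong[OF refl g_eq]) (auto intro: G(1))
    ultimately show "continuous (at z) g"
      by (intro continuous_on_interior) auto
  qed
  have exp_g: "f z = f 0 * exp (g z)" for z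
    unfolding g_def by (rule exp_G) (simp add: norm_le)
  show ?thesis
  proof (intro ex1I conjI allI)
    show "continuous_on UNIV g" "f z = f 0 * exp (g z)" for z
      by (fact cont_g exp_g)+
    show "g 0 = 0"
      by (simp add: g_def G)
    fix h
    assume h: "continuous_on UNIV h \<and> h 0 = 0 \<and> (\<forall>z. f z = f 0 * exp (h z))"
    show "h = g"
    proof
      fix z
      show "h z = g z"
      proof (rule continuous_logarithm_unique[OF connected_UNIV _ cont_g])
        show "exp (h z) = exp (g z)" for z
          by (rule cancel) (metis h exp_g)
        show "h 0 = g 0"
          using h \<open>g 0 = 0\<close> by simp
      qed (use h in auto)
    qed
  qed
qed

theorem theorem7p4:
  fixes f :: "real ^ 'n \<Rightarrow> 'a :: comm_complex_banach_algebra_1"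
  assumes "semisimple TYPE('a)"
    and "connected_space (gelfand_space :: ('a \<Rightarrow> complex) topology)"
    and "continuous_on UNIV f"
    and "\<And>z. f z dvd 1"
  shows "\<exists>!g :: real ^ 'n \<Rightarrow> 'a.
    continuous_on UNIV g \<and> g 0 = 0 \<and> (\<forall>z. f z = f 0 * exp (g z))"
  using continuous_logarithm[OF assms(3,4)] .

end
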